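(* Let $\lambda$ be a partition with $|\lambda|\ge 2$. Then $$F_{\lambda}\,\mathrm{He}_{\lambda}(x) = x\sum_{\mu\in T_1(\lambda)} F_{\mu}\,\mathrm{He}_{\mu}(x) + (|\lambda|-1)\sum_{\rho\in \tilde{T}_2(\lambda)} \mathrm{sgn}(\rho,\lambda)\,F_{\rho}\,\mathrm{He}_{\rho}(x).$$
   Context: A partition $\lambda=(\lambda_1\ge\dots\ge\lambda_r>0)$ has length $r$ and size $|\lambda|=\sum_i\lambda_i$; $\varnothing$ is the partition of $0$. Set $\lambda_i=0$ for $i>r$. Partial order: $\mu\le\lambda$ iff $\mu_i\le\lambda_i$ for all $i$. $F_\lambda$ is the number of standard Young tableaux of shape $\lambda$ (with $F_\varnothing=1$). Hermite polynomials: $\mathrm{He}_0(x)=1$, $\mathrm{He}_1(x)=x$, $\mathrm{He}_n(x)=x\,\mathrm{He}_{n-1}(x)-(n-1)\,\mathrm{He}_{n-2}(x)$ for $n\ge2$. The degree sequence of $\lambda$ of length $r$ is $n_\lambda=(n_1,\dots,n_r)$ with $n_i=\lambda_i+r-i$, and $\Delta(n_\lambda)=\prod_{1\le i<j\le r}(n_j-n_i)$. The Wronskian is $\mathrm{Wr}[f_1,\dots,f_r]=\det\big(f_j^{(i-1)}\big)_{1\le i,j\le r}$. The Wronskian Hermite polynomial of $\lambda$ is $\mathrm{He}_\lambda=\mathrm{Wr}[\mathrm{He}_{n_1},\dots,\mathrm{He}_{n_r}]/\Delta(n_\lambda)$, with $\mathrm{He}_\varnothing=1$. $T_k(\lambda)=\{\mu\le\lambda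 : |\mu|=|\lambda|-k\}$ for $k\le|\lambda|$. $T_2^h(\lambda)=\{\rho\in T_2(\lambda): \exists i,\ \rho_i=\lambda_i-2\}$ (two horizontally adjacent cells removed). $T_2^v(\lambda)=\{\rho\in T_2(\lambda): \exists i,\ \rho_i=\rho_{i+1}=\lambda_i-1=\lambda_{i+1}-1\}$ (two vertically adjacent cells removed). $\tilde T_2(\lambda)=T_2^h(\lambda)\cup T_2^v(\lambda)$; for $\rho\in\tilde T_2(\lambda)$, $\mathrm{sgn}(\rho,\lambda)=-1$ if $\rho\in T_2^h(\lambda)$ and $\mathrm{sgn}(\rho,\lambda)=1$ if $\rho\in T_2^v(\lambda)$. *)

theory Defs
  imports Complex_Main "HOL-Library.FuncSet" "Jordan_Normal_Form.Determinant"
begin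

text \<open>
  A partition is the list of its parts, in weakly decreasing order and without zeros; the empty
  list is the partition of 0. Its length is \<open>length\<close>, its size is \<open>sum_list\<close>.
  All indices of parts, rows and columns start at 0.
\<close>

definition is_partition :: "nat list \<Rightarrow> bool" where
  "is_partition lam \<longleftrightarrow> sorted_wrt (\<ge>) lam \<and> 0 \<notin> set lam"

definition part :: "nat list \<Rightarrow> nat \<Rightarrow> nat" where
  "part lam i = (if i < length lam then lam ! i else 0)"

definition part_le :: "nat list \<Rightarrow> nat list \<Rightarrow> bool" where
  "part_le mu lam \<longleftrightarrow> (\<forall>i. part mu i \<le> part lam i)"

definition young_diagram :: "nat list \<Rightarrow> (nat \<times> nat) set" where
  "young_diagram lam = {(i, j). i < length lam \<and> j < lam ! i}"

text \<open>Tableaux are extensional functions on the diagram, so that each filling is counted once.\<close>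

definition standard_tableaux :: "nat list \<Rightarrow> (nat \<times> nat \<Rightarrow> nat) set" where
  "standard_tableaux lam =
     {T \<in> extensional (young_diagram lam).
        bij_betw T (young_diagram lam) {1..sum_list lam} \<and>
        (\<forall>i j k. (i, j) \<in> young_diagram lam \<and> (i, k) \<in> young_diagram lam \<and> j < k
                   \<longrightarrow> T (i, j) < T (i, k)) \<and>
        (\<forall>i k j. (i, j) \<in> young_diagram lam \<and> (k, j) \<in> young_diagram lam \<and> i < k
                   \<longrightarrow> T (i, j) < T (k, j))}"

definition num_SYT :: "nat list \<Rightarrow> nat" where
  "num_SYT lam = card (standard_tableaux lam)"

fun Hermite :: "nat \<Rightarrow> real poly" where
  "Hermite 0 = 1"
| "Hermite (Suc 0) = [:0, 1:]"
| "Hermite (Suc (Suc n)) = [:0, 1:] * Hermite (Suc n) - of_nat (Suc n) * Hermite n"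

text \<open>
  With 0-based indices the degree \<open>\<lambda>\<^sub>i + r - i\<close> becomes \<open>lam ! i + (r - Suc i)\<close>.
\<close>

definition degree_seq :: "nat list \<Rightarrow> nat list" where
  "degree_seq lam = map (\<lambda>i. lam ! i + (length lam - Suc i)) [0..<length lam]"

definition vandermonde :: "nat list \<Rightarrow> real" where
  "vandermonde n = (\<Prod>j<length n. \<Prod>i<j. real (n ! j) - real (n ! i))"

definition Wronskian :: "real poly list \<Rightarrow> real poly" where
  "Wronskian fs = det (mat (length fs) (length fs) (\<lambda>(i, j). (pderiv ^^ i) (fs ! j)))"

definition Wronskian_Hermite :: "nat list \<Rightarrow> real poly" where
  "Wronskian_Hermite lam =
     smult (1 / vandermonde (degree_seq lam)) (Wronskian (map Hermite (degree_seq lam)))"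

definition T_set :: "nat \<Rightarrow> nat list \<Rightarrow> nat list set" where
  "T_set k lam = {mu. is_partition mu \<and> part_le mu lam \<and> sum_list mu + k = sum_list lam}"

text \<open>The conditions on parts below are written additively because subtraction on \<open>nat\<close> truncates.\<close>

definition T2_horizontal :: "nat list \<Rightarrow> nat list set" where
  "T2_horizontal lam = {rho \<in> T_set 2 lam. \<exists>i. part rho i + 2 = part lam i}"

definition T2_vertical :: "nat list \<Rightarrow> nat list set" where
  "T2_vertical lam =
     {rho \<in> T_set 2 lam. \<exists>i. part rho i = part rho (Suc i) \<and>
        part rho i + 1 = part lam i \<and> part rho (Suc i) + 1 = part lam (Suc i)}"

definition T2_domino :: "nat list \<Rightarrow> nat list set" where
  "T2_domino lam = T2_horizontal lam \<union> T2_vertical lam"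

definition domino_sgn :: "nat list \<Rightarrow> nat list \<Rightarrow> real" where
  "domino_sgn rho lam = (if rho \<in> T2_horizontal lam then - 1 else 1)"

lemma T2_horizontal_vertical_disjoint: "T2_horizontal lam \<inter> T2_vertical lam = {}"
proof -
  have False if r: "is_partition rho" "part_le rho lam" "sum_list rho + 2 = sum_list lam"
    and h: "part rho i + 2 = part lam i"
    and v: "part rho j + 1 = part lam j" for rho i j
  proof -
    define N where "N = max (length lam) (length rho)"
    have s: "sum_list xs = (\<Sum>k<N. part xs k)" if "length xs \<le> N" for xs
    proof -
      have "sum_list xs = (\<Sum>k<length xs. part xs k)"
        by (simp add: sum_list_sum_nth part_def atLeast0LessThan)
      also have "\<dots> = (\<Sum>k<N. part xs k)"
        using that by (intro sum.mono_neutral_left) (auto simp: part_def)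
      finally show ?thesis .
    qed
    have "i < N" "j < N" "i \<noteq> j"
      using h v by (auto simp: part_def N_def split: if_splits)
    hence "(\<Sum>k<N. part rho k + (if k = i then 2 else 0) + (if k = j then 1 else 0))
             = sum_list rho + 3"
      by (simp add: sum.distrib s N_def)
    moreover have "(\<Sum>k<N. part rho k + (if k = i then 2 else 0) + (if k = j then 1 else 0))
             \<le> (\<Sum>k<N. part lam k)"
      using r(2) h v \<open>i \<noteq> j\<close> by (intro sum_mono) (auto simp: part_le_def)
    ultimately show False using r(3) s[of lam] by (simp add: N_def)
  qed
  thus ?thesis unfolding T2_horizontal_def T2_vertical_def T_set_def by blast
qed

lemma finite_T_set: "finite (T_set k lam)"
proof (rule finite_subset)
  show "T_set k lam \<subseteq> {mu. set mu \<subseteq> {..sum_list lam} \<and> length mu \<le> sum_list lam}"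
  proof safe
    fix mu x assume mu: "mu \<in> T_set k lam"
    have "length mu \<le> sum_list mu" if "0 \<notin> set mu"
      using that by (induction mu) auto
    thus "length mu \<le> sum_list lam"
      using mu by (auto simp: T_set_def is_partition_def)
    assume "x \<in> set mu"
    hence "x \<le> sum_list mu" by (simp add: member_le_sum_list)
    thus "x \<le> sum_list lam" using mu by (auto simp: T_set_def)
  qed
qed (simp add: finite_lists_length_le)

lemma num_SYT_Nil: "num_SYT [] = 1"
proof -
  have "standard_tableaux [] = {\<lambda>_. undefined}"
    by (auto simp: standard_tableaux_def young_diagram_def bij_betw_def)
  thus ?thesis by (simp add: num_SYT_def)
qed

lemma Wronskian_Hermite_Nil: "Wronskian_Hermite [] = 1"
  by (simp add: Wronskian_Hermite_def degree_seq_def vandermonde_def Wronskian_def)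

end

theory Submission
  imports Defs
begin

text \<open>
  Since \<open>He\<^sub>n' = n He\<^sub>n\<^sub>-\<^sub>1\<close>, the Wronskian is, up to \<open>\<Prod>j. n\<^sub>j!\<close> and a sign, the Jacobi-Trudi determinant
  \<open>s\<^sub>\<lambda> = det (h (\<lambda>\<^sub>j - j + i))\<close> with \<open>h n = He\<^sub>n / n!\<close>; the Vandermonde product \<open>\<Delta>\<close> is, up to the same
  factor and sign, the same determinant with \<open>h n = 1 / n!\<close>. Both sequences satisfy
  \<open>n * h n = x * h (n - 1) + y * h (n - 2)\<close>, with \<open>y = -1\<close> and with \<open>x = 1, y = 0\<close> respectively.
  Applying this recurrence column by column gives
  \<open>|\<lambda>| s\<^sub>\<lambda> = x (\<Sum>\<mu>. s\<^sub>\<mu>) + y (\<Sum>\<rho>. \<plusminus> s\<^sub>\<rho>)\<close>, where \<open>\<mu>\<close> arises by removing a corner and \<open>\<rho>\<close> by removing a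
  domino. For \<open>h n = 1 / n!\<close> this is the branching rule for standard tableaux, so
  \<open>F\<^sub>\<lambda> = |\<lambda>|! s\<^sub>\<lambda>\<close> there and hence \<open>F\<^sub>\<lambda> He\<^sub>\<lambda> = |\<lambda>|! s\<^sub>\<lambda>\<close> for the Hermite sequence; the recurrence for the
  latter is the claim.
\<close>

subsection \<open>Jacobi-Trudi determinants of Appell coefficients\<close>

text \<open>Row \<open>i\<close> evaluates a monic polynomial of degree \<open>i\<close> at the
  points \<open>a j\<close>, so the value is the Vandermonde product for every choice of nodes
  \<open>c k\<close>. The nodes \<open>c k = k\<close> turn the entries into falling
  factorials.\<close>

lemma det_Newton_basis:
  fixes a c :: "nat \<Rightarrow> 'a :: comm_ring_1"
  shows "det (mat r r (\<lambda>(i, j). \<Prod>k<i. a j - c k)) = (\<Prod>j<r. \<Prod>i<j. a j - a i)"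
proof (induction r arbitrary: a)
  case 0
  show ?case by simp
next
  case (Suc r)
  define M where "M = mat (Suc r) (Suc r) (\<lambda>(i, j). \<Prod>k<i. a j - c k)"
  define L where "L = mat (Suc r) (Suc r)
    (\<lambda>(i, k). (if k = i then 1 else 0) + (if i = Suc k then c k - a 0 else 0))"
  define N where "N = mat (Suc r) (Suc r)
    (\<lambda>(i, j). if i = 0 then 1 else (a j - a 0) * (\<Prod>k<i - 1. a j - c k))"
  have carr: "M \<in> carrier_mat (Suc r) (Suc r)" "L \<in> carrier_mat (Suc r) (Suc r)"
    "N \<in> carrier_mat (Suc r) (Suc r)"
    by (auto simp: M_def L_def N_def)
  \<comment> \<open>Subtracting \<open>a 0 - c k\<close> times row \<open>k\<close> from row \<open>k + 1\<close> clears column 0 below its top entry.\<close>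
  have "L * M = N"
  proof (rule eq_matI)
    fix i j assume "i < dim_row N" "j < dim_col N"
    hence ij: "i < Suc r" "j < Suc r" by (auto simp: N_def)
    have "(L * M) $$ (i, j) = (\<Sum>k\<in>{0..<Suc r}. L $$ (i, k) * M $$ (k, j))"
      using ij by (auto simp: L_def M_def scalar_prod_def intro!: sum.cong)
    also have "\<dots> = (\<Sum>k\<in>{0..<Suc r}. (if k = i then M $$ (k, j) else 0) +
        (if i = Suc k then (c k - a 0) * M $$ (k, j) else 0))"
      using ij by (intro sum.cong) (auto simp: L_def algebra_simps)
    also have "\<dots> = M $$ (i, j) + (\<Sum>k\<in>{0..<Suc r}. if i = Suc k then (c k - a 0) * M $$ (k, j) else 0)"
      using ij by (simp add: sum.distrib sum.delta')
    also have "(\<Sum>k\<in>{0..<Suc r}. if i = Suc k then (c k - a 0) * M $$ (k, j) else 0) =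
        (if i = 0 then 0 else (c (i - 1) - a 0) * M $$ (i - 1, j))"
    proof (cases i)
      case (Suc i')
      thus ?thesis using ij
        by (simp add: sum.delta' eq_commute[of i'])
    qed simp
    finally show "(L * M) $$ (i, j) = N $$ (i, j)"
      using ij by (cases i) (auto simp: M_def N_def algebra_simps)
  qed (auto simp: L_def M_def N_def)
  moreover have "det L = 1"
  proof -
    have "det L = prod_list (diag_mat L)"
      by (rule det_lower_triangular[of "Suc r"]) (auto simp: L_def)
    also have "\<dots> = 1"
      unfolding prod_list_diag_prod by (auto simp: L_def intro!: prod.neutral)
    finally show ?thesis .
  qed
  ultimately have "det M = det N"
    using det_mult[OF carr(2,1)] by simp
  also have "\<dots> = (\<Sum>i<Suc r. N $$ (i, 0) * cofactor N i 0)"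
    by (rule laplace_expansion_column[OF carr(3)]) simp
  also have "\<dots> = cofactor N 0 0"
    by (subst sum.lessThan_Suc_shift) (auto simp: N_def intro!: sum.neutral)
  also have "\<dots> = det (mat_delete N 0 0)"
    by (simp add: cofactor_def)
  \<comment> \<open>Each remaining column \<open>j\<close> carries the factor
    \<open>a (Suc j) - a 0\<close>. Transposing turns columns into rows, the form on which
    \<open>det_rows_mul\<close> acts.\<close>
  also have "mat_delete N 0 0 =
      (mat\<^sub>r r r (\<lambda>j. (a (Suc j) - a 0) \<cdot>\<^sub>v vec r (\<lambda>i. \<Prod>k<i. a (Suc j) - c k)))\<^sup>T"
    by (rule eq_matI) (auto simp: N_def mat_delete_def)
  also have "det \<dots> = (\<Prod>j<r. a (Suc j) - a 0) *
      det ((mat\<^sub>r r r (\<lambda>j. vec r (\<lambda>i. \<Prod>k<i. a (Suc j) - c k)))\<^sup>T)"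
    by (subst (1 2) det_transpose[where n = r])
       (auto simp: det_rows_mul atLeast0LessThan)
  also have "(mat\<^sub>r r r (\<lambda>j. vec r (\<lambda>i. \<Prod>k<i. a (Suc j) - c k)))\<^sup>T =
      mat r r (\<lambda>(i, j). \<Prod>k<i. a (Suc j) - c k)"
    by (rule eq_matI) auto
  also have "det \<dots> = (\<Prod>j<r. \<Prod>i<j. a (Suc j) - a (Suc i))"
    by (rule Suc.IH)
  also have "(\<Prod>j<r. a (Suc j) - a 0) * \<dots> = (\<Prod>j<Suc r. \<Prod>i<j. a j - a i)"
    by (simp add: prod.lessThan_Suc_shift prod.distrib del: prod.lessThan_Suc)
  finally show ?case by (simp add: M_def)
qed

lemma det_mult_cols:
  fixes f :: "nat \<Rightarrow> 'a :: comm_ring_1"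
  shows "det (mat n n (\<lambda>(i, j). f j * g i j)) = (\<Prod>j<n. f j) * det (mat n n (\<lambda>(i, j). g i j))"
proof -
  have "det (mat n n (\<lambda>(i, j). f j * g i j)) =
      (\<Sum>p | p permutes {0..<n}. signof p * (\<Prod>j<n. f j * g (p j) j))"
    by (subst det_col[where n = n]) (auto intro!: sum.cong prod.cong dest: permutes_in_image)
  also have "\<dots> = (\<Prod>j<n. f j) * (\<Sum>p | p permutes {0..<n}. signof p * (\<Prod>j<n. g (p j) j))"
    by (simp add: prod.distrib sum_distrib_left ac_simps)
  also have "(\<Sum>p | p permutes {0..<n}. signof p * (\<Prod>j<n. g (p j) j)) =
      det (mat n n (\<lambda>(i, j). g i j))"
    by (subst det_col[where n = n]) (auto intro!: sum.cong prod.cong dest: permutes_in_image)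
  finally show ?thesis .
qed

text \<open>
  The recurrence says that \<open>\<Sum>n. H n * t ^ n\<close> is \<open>exp (x * t + y * t\<^sup>2 / 2)\<close>, with denominators cleared.
\<close>

locale appell_coefficients =
  fixes H :: "int \<Rightarrow> 'a :: comm_ring_1" and x y :: 'a
  assumes H_0: "H 0 = 1"
    and H_neg: "n < 0 \<Longrightarrow> H n = 0"
    and H_rec: "of_int n * H n = x * H (n - 1) + y * H (n - 2)"
begin

text \<open>Here \<open>b\<close> is any integer sequence, so that columns can be lowered or swapped
  even when the result belongs to no partition.\<close>

definition shifted_det :: "nat \<Rightarrow> (nat \<Rightarrow> int) \<Rightarrow> 'a" where
  "shifted_det r b = det (mat r r (\<lambda>(i, j). H (b j + int i)))"

lemma shifted_det_col: "shifted_det r b = (\<Sum>p | p permutes {0..<r}. signof p * (\<Prod>j<r. H (b j + int (p j))))"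
  unfolding shifted_det_def
  by (subst det_col[where n = r]) (auto intro!: sum.cong prod.cong dest: permutes_in_image)

lemma shifted_det_cong: "(\<And>j. j < r \<Longrightarrow> b j = b' j) \<Longrightarrow> shifted_det r b = shifted_det r b'"
  by (simp add: shifted_det_col)

text \<open>
  The recurrence for \<open>H\<close> applies to the entry of row \<open>i\<close>, column \<open>j\<close> with factor \<open>b j + i\<close>. In each
  term of the Leibniz expansion the row contributions \<open>i\<close> add up to \<open>\<Sum>j<r. j\<close>, independently of
  the permutation.
\<close>

lemma shifted_det_rec:
  "of_int ((\<Sum>j<r. b j) + (\<Sum>j<r. int j)) * shifted_det r b =
     x * (\<Sum>j<r. shifted_det r (b(j := b j - 1))) + y * (\<Sum>j<r. shifted_det r (b(j := b j - 2)))"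
proof -
  let ?P = "\<lambda>b p. \<Prod>j<r. H (b j + int (p j))"
  have *: "of_int ((\<Sum>j<r. b j) + (\<Sum>j<r. int j)) * ?P b p =
      x * (\<Sum>j<r. ?P (b(j := b j - 1)) p) + y * (\<Sum>j<r. ?P (b(j := b j - 2)) p)"
    if p: "p permutes {0..<r}" for p
  proof -
    have "(\<Sum>j<r. int j) = (\<Sum>j<r. int (p j))"
      using sum.permute[OF p, of int] by (simp add: atLeast0LessThan o_def)
    hence "of_int ((\<Sum>j<r. b j) + (\<Sum>j<r. int j)) * ?P b p =
        (\<Sum>j<r. of_int (b j + int (p j)) * ?P b p)"
      by (simp only: sum.distrib[symmetric] of_int_sum sum_distrib_right)
    also have "\<dots> = (\<Sum>j<r. x * ?P (b(j := b j - 1)) p + y * ?P (b(j := b j - 2)) p)"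
    proof (rule sum.cong)
      fix j assume j: "j \<in> {..<r}"
      \<comment> \<open>Changing \<open>b j\<close> affects only the factor of column
        \<open>j\<close>; \<open>Q\<close> collects the others.\<close>
      define Q where "Q = (\<Prod>k\<in>{..<r} - {j}. H (b k + int (p k)))"
      have split: "?P (b(j := z)) p = H (z + int (p j)) * Q" for z
        using j by (subst prod.remove[of _ j]) (auto simp: Q_def intro!: prod.cong)
      have "of_int (b j + int (p j)) * H (b j + int (p j)) =
          x * H (b j - 1 + int (p j)) + y * H (b j - 2 + int (p j))"
        using H_rec[of "b j + int (p j)"] by (simp add: algebra_simps)
      thus "of_int (b j + int (p j)) * ?P b p =
          x * ?P (b(j := b j - 1)) p + y * ?P (b(j := b j - 2)) p"
        using split[of "b j"]
        unfolding split[of "b j - 1"] split[of "b j - 2"] fun_upd_triv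
        by (metis (no_types, lifting) mult.assoc distrib_right)
    qed simp
    finally show ?thesis by (simp add: sum.distrib sum_distrib_left)
  qed
  have "of_int ((\<Sum>j<r. b j) + (\<Sum>j<r. int j)) * shifted_det r b =
      (\<Sum>p | p permutes {0..<r}. signof p * (of_int ((\<Sum>j<r. b j) + (\<Sum>j<r. int j)) * ?P b p))"
    unfolding shifted_det_col by (simp only: sum_distrib_left mult.left_commute)
  also have "\<dots> = (\<Sum>p | p permutes {0..<r}. signof p *
      (x * (\<Sum>j<r. ?P (b(j := b j - 1)) p) + y * (\<Sum>j<r. ?P (b(j := b j - 2)) p)))"
    using * by (intro sum.cong) auto
  also have "\<dots> = x * (\<Sum>j<r. shifted_det r (b(j := b j - 1))) + y * (\<Sum>j<r. shifted_det r (b(j := b j - 2)))"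
    unfolding shifted_det_col
    by (simp only: distrib_left sum.distrib sum_distrib_left mult.left_commute
        sum.swap[of _ "{..<r}"])
  finally show ?thesis .
qed

lemma shifted_det_transpose:
  assumes "j < r" "k < r" "j \<noteq> k"
  shows "shifted_det r (b \<circ> transpose j k) = - shifted_det r b"
proof -
  let ?M = "\<lambda>b. mat r r (\<lambda>(i, j). H (b j + int i))"
  have "shifted_det r (b \<circ> transpose j k) =
      det (mat r r (\<lambda>(i, l). (?M b)\<^sup>T $$ (transpose j k i, l)))"
    unfolding shifted_det_def
    by (subst det_transpose[symmetric, where n = r])
       (use assms in \<open>auto intro!: arg_cong[of _ _ det] simp: transpose_def\<close>)
  also have "\<dots> = signof (transpose j k) * det ((?M b)\<^sup>T)"
    by (rule det_permute_rows) (use assms in \<open>auto intro!: permutes_swap_id\<close>)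
  also have "\<dots> = - shifted_det r b"
    using assms unfolding shifted_det_def by (subst det_transpose[where n = r]) (auto simp: sign_swap_id)
  finally show ?thesis .
qed

lemma shifted_det_eq_zero:
  assumes "j < r" "k < r" "j \<noteq> k" "b j = b k"
  shows "shifted_det r b = 0"
proof -
  let ?M = "mat r r (\<lambda>(i, j). H (b j + int i))"
  have "shifted_det r b = det ?M\<^sup>T"
    unfolding shifted_det_def by (subst det_transpose[where n = r]) auto
  also have "\<dots> = 0"
    by (rule det_identical_rows[where i = j and j = k and n = r]) (use assms in auto)
  finally show ?thesis .
qed

text \<open>Row indices are at most \<open>r - 1\<close>, so all arguments of \<open>H\<close> in
  column \<open>j\<close> are negative and the column vanishes.\<close>

lemma shifted_det_neg_eq_zero:
  assumes "j < r" "b j \<le> - int r"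
  shows "shifted_det r b = 0"
  unfolding shifted_det_col
proof (intro sum.neutral ballI)
  fix p assume "p \<in> {p. p permutes {0..<r}}"
  hence "p j < r" using assms(1) by (auto dest: permutes_in_image)
  hence "H (b j + int (p j)) = 0" using assms by (intro H_neg) auto
  hence "(\<Prod>j<r. H (b j + int (p j))) = 0"
    using assms(1) by (intro prod_zero) auto
  thus "signof p * (\<Prod>j<r. H (b j + int (p j))) = 0" by simp
qed

text \<open>The last column is zero except for \<open>H 0 = 1\<close> at the bottom. As
  \<open>- int r\<close> is the shifted value of a zero part in row \<open>r\<close>, appending such
  a part leaves the determinant unchanged.\<close>

lemma shifted_det_Suc:
  assumes "b r = - int r"
  shows "shifted_det (Suc r) b = shifted_det r b"
proof -
  let ?M = "mat (Suc r) (Suc r) (\<lambda>(i, j). H (b j + int i))"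
  have "shifted_det (Suc r) b = (\<Sum>i<Suc r. ?M $$ (i, r) * cofactor ?M i r)"
    unfolding shifted_det_def by (rule laplace_expansion_column) auto
  also have "\<dots> = cofactor ?M r r"
    using assms by (auto simp: H_0 H_neg intro!: sum.neutral)
  also have "\<dots> = det (mat_delete ?M r r)"
    by (simp add: cofactor_def)
  also have "mat_delete ?M r r = mat r r (\<lambda>(i, j). H (b j + int i))"
    by (rule eq_matI) (auto simp: mat_delete_def)
  finally show ?thesis by (simp add: shifted_det_def)
qed

end

subsection \<open>Hermite polynomials and reciprocal factorials\<close>

text \<open>The coefficient of \<open>t ^ n\<close> in \<open>exp (x * t - t\<^sup>2 / 2)\<close>.
  Extending it by 0 to negative indices makes differentiation an index shift for every
  integer.\<close>

definition Hermite_divided :: "int \<Rightarrow> real poly" where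
  "Hermite_divided n = (if n < 0 then 0 else smult (1 / fact (nat n)) (Hermite (nat n)))"

definition inv_fact :: "int \<Rightarrow> real" where
  "inv_fact n = (if n < 0 then 0 else 1 / fact (nat n))"

lemma Suc_div_fact: "real (Suc m) / fact (Suc m) = 1 / fact m"
  by (simp add: fact_Suc del: of_nat_Suc)

lemma inv_fact_rec: "of_int n * inv_fact n = inv_fact (n - 1)"
proof (cases "n \<le> 0")
  case False
  then obtain m where "n = int (Suc m)" by (metis not_le pos_int_cases Suc_pred)
  thus ?thesis by (simp add: inv_fact_def nat_add_distrib)
qed (auto simp: inv_fact_def)

interpretation inv_fact: appell_coefficients inv_fact 1 0
  by unfold_locales (simp add: inv_fact_def, simp add: inv_fact_def, simp add: inv_fact_rec)

text \<open>This is the recurrence of \<open>Hermite\<close> divided by \<open>fact (n - 1)\<close>,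
  whose factor \<open>n - 1\<close> cancels the coefficient of the last term. The zero values at
  negative indices cover \<open>n \<le> 1\<close>.\<close>

lemma Hermite_divided_rec:
  "of_int n * Hermite_divided n = [:0, 1:] * Hermite_divided (n - 1) - Hermite_divided (n - 2)"
proof -
  consider "n < 0" | "n = 0" | "n = 1" | m where "n = int (Suc (Suc m))"
    by (metis One_nat_def Suc_pred int_ops(2) linorder_neqE_linordered_idom of_nat_0 not_gr_zero pos_int_cases)
  thus ?thesis
  proof cases
    case (4 m)
    have "of_int n * Hermite_divided n = smult (real (Suc (Suc m)) / fact (Suc (Suc m))) (Hermite (Suc (Suc m)))"
      using 4 by (simp add: Hermite_divided_def of_int_poly nat_add_distrib)
    also have "real (Suc (Suc m)) / fact (Suc (Suc m)) = 1 / fact (Suc m)"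
      by (rule Suc_div_fact)
    also have "smult (1 / fact (Suc m)) (Hermite (Suc (Suc m))) =
        [:0, 1:] * smult (1 / fact (Suc m)) (Hermite (Suc m)) -
        smult (real (Suc m) / fact (Suc m)) (Hermite m)"
      by (simp add: smult_diff_right of_nat_poly)
    also have "real (Suc m) / fact (Suc m) = 1 / fact m"
      by (rule Suc_div_fact)
    finally show ?thesis
      using 4 by (simp add: Hermite_divided_def nat_add_distrib)
  qed (auto simp: Hermite_divided_def)
qed

interpretation Hermite_divided: appell_coefficients Hermite_divided "[:0, 1:]" "- 1"
  by unfold_locales
     (simp add: Hermite_divided_def, simp add: Hermite_divided_def, simp add: Hermite_divided_rec)

text \<open>Differentiating the recurrence and inserting the two previous derivatives leaves
  \<open>Hermite (n + 2)\<close> plus \<open>n + 2\<close> times the right-hand side of the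
  recurrence for \<open>Hermite (n + 2)\<close>.\<close>

lemma pderiv_Hermite: "pderiv (Hermite (Suc n)) = of_nat (Suc n) * Hermite n"
proof (induction n rule: induct_nat_012)
  case (ge2 n)
  have "pderiv (Hermite (Suc (Suc (Suc n)))) =
      Hermite (Suc (Suc n)) + [:0, 1:] * pderiv (Hermite (Suc (Suc n)))
      - of_nat (Suc (Suc n)) * pderiv (Hermite (Suc n))"
    by (simp only: Hermite.simps pderiv_diff pderiv_mult pderiv_pCons pderiv_of_nat) simp
  also have "\<dots> = Hermite (Suc (Suc n)) + of_nat (Suc (Suc n)) *
      ([:0, 1:] * Hermite (Suc n) - of_nat (Suc n) * Hermite n)"
    unfolding ge2 by (simp only: algebra_simps)
  also have "\<dots> = of_nat (Suc (Suc (Suc n))) * Hermite (Suc (Suc n))"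
    by (simp only: Hermite.simps(3) of_nat_Suc[of "Suc (Suc n)"] distrib_right mult_1)
  finally show ?case .
qed (simp_all add: pderiv_pCons pderiv_diff numeral_poly)

lemma pderiv_Hermite_divided: "pderiv (Hermite_divided n) = Hermite_divided (n - 1)"
proof -
  consider "n < 0" | "n = 0" | m where "n = int (Suc m)"
    by (metis linorder_neqE_linordered_idom pos_int_cases Suc_pred)
  thus ?thesis
  proof cases
    case (3 m)
    show ?thesis
      using 3 Suc_div_fact[of m]
      by (simp add: Hermite_divided_def pderiv_smult pderiv_Hermite of_nat_poly nat_add_distrib del: Hermite.simps)
  qed (auto simp: Hermite_divided_def)
qed

text \<open>The factor \<open>fact n\<close> is the same for all orders \<open>i\<close>, so it
  comes out of a whole column of the Wronskian.\<close>

lemma higher_pderiv_Hermite: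
  "(pderiv ^^ i) (Hermite n) = smult (fact n) (Hermite_divided (int n - int i))"
proof (induction i)
  case 0
  show ?case by (simp add: Hermite_divided_def)
next
  case (Suc i)
  have "int n - int i - 1 = int n - int (Suc i)" by simp
  thus ?case using Suc
    by (simp only: funpow.simps o_apply pderiv_smult pderiv_Hermite_divided)
qed

text \<open>These are the Newton basis entries for the nodes 0, 1, 2 and so on, with the same column
  factor as in \<open>higher_pderiv_Hermite\<close>. For \<open>i > m\<close> both sides are
  0.\<close>

lemma falling_factorial_inv_fact: "(\<Prod>k<i. real m - real k) = fact m * inv_fact (int m - int i)"
proof (induction i)
  case 0
  show ?case by (simp add: inv_fact_def)
next
  case (Suc i)
  have "(\<Prod>k<Suc i. real m - real k) = fact m * (of_int (int m - int i) * inv_fact (int m - int i))"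
    by (simp add: Suc)
  also have "\<dots> = fact m * inv_fact (int m - int (Suc i))"
    by (subst inv_fact_rec) (simp add: algebra_simps)
  finally show ?case .
qed

section \<open>Wronskian and Vandermonde product as Jacobi-Trudi determinants\<close>

text \<open>
  The Jacobi-Trudi matrix lists the rows of the Wronskian and Vandermonde matrices in reverse order;
  the sign of this reversal cancels in \<open>Wronskian_Hermite\<close>.
\<close>

definition reversal :: "nat \<Rightarrow> nat \<Rightarrow> nat" where
  "reversal r i = (if i < r then r - Suc i else i)"

lemma reversal_permutes: "reversal r permutes {0..<r}"
proof (rule bij_imp_permutes)
  show "bij_betw (reversal r) {0..<r} {0..<r}"
    by (rule bij_betwI[where g = "reversal r"]) (auto simp: reversal_def)
qed (auto simp: reversal_def)

text \<open>Using \<open>part\<close> extends the sequence past the length of \<open>lam\<close>.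
  For a partition it is strictly decreasing.\<close>

definition shifted_part :: "nat list \<Rightarrow> nat \<Rightarrow> int" where
  "shifted_part lam j = int (part lam j) - int j"

context appell_coefficients
begin

text \<open>By the Jacobi-Trudi formula, the Schur function of \<open>lam\<close> when the complete
  homogeneous symmetric function of degree \<open>n\<close> is specialised to
  \<open>H n\<close>.\<close>

definition schur :: "nat list \<Rightarrow> 'a" where
  "schur lam = shifted_det (length lam) (shifted_part lam)"

text \<open>Entrywise,
  \<open>degree_seq lam ! j - i = (part lam j - j) + (r - 1 - i)\<close>.\<close>

lemma det_degree_seq:
  fixes lam :: "nat list"
  defines "r \<equiv> length lam"
  shows "det (mat r r (\<lambda>(i, j). H (int (degree_seq lam ! j) - int i))) =
    signof (reversal r) * schur lam"
proof -
  have "mat r r (\<lambda>(i, j). H (int (degree_seq lam ! j) - int i)) =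
      mat r r (\<lambda>(i, j). mat r r (\<lambda>(i, j). H (shifted_part lam j + int i)) $$ (reversal r i, j))"
    by (rule eq_matI)
       (auto simp: reversal_def degree_seq_def shifted_part_def part_def r_def of_nat_diff algebra_simps)
  also have "det \<dots> = signof (reversal r) * det (mat r r (\<lambda>(i, j). H (shifted_part lam j + int i)))"
    by (rule det_permute_rows) (auto intro: reversal_permutes)
  finally show ?thesis by (simp add: schur_def shifted_det_def r_def)
qed

end

text \<open>With the nodes \<open>c k = k\<close> the Vandermonde matrix matches the Wronskian one
  entry by entry: \<open>inv_fact\<close> stands for \<open>Hermite_divided\<close>, and the column
  factors are the same.\<close>

lemma vandermonde_degree_seq:
  "vandermonde (degree_seq lam) =
     (\<Prod>j<length lam. fact (degree_seq lam ! j)) * (signof (reversal (length lam)) * inv_fact.schur lam)"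
proof -
  have "vandermonde (degree_seq lam) = det (mat (length lam) (length lam)
      (\<lambda>(i, j). \<Prod>k<i. real (degree_seq lam ! j) - real k))"
    unfolding vandermonde_def by (subst det_Newton_basis) (simp add: degree_seq_def)
  also have "\<dots> = (\<Prod>j<length lam. fact (degree_seq lam ! j)) *
      det (mat (length lam) (length lam) (\<lambda>(i, j). inv_fact (int (degree_seq lam ! j) - int i)))"
    unfolding falling_factorial_inv_fact by (rule det_mult_cols)
  finally show ?thesis by (simp add: inv_fact.det_degree_seq)
qed

lemma prod_const_poly: "(\<Prod>j<n::nat. [:f j:]) = [:\<Prod>j<n. f j :: 'a :: comm_semiring_1:]"
  by (induction n) (simp_all add: one_pCons mult.commute)

lemma Wronskian_degree_seq:
  "Wronskian (map Hermite (degree_seq lam)) = smult (\<Prod>j<length lam. fact (degree_seq lam ! j))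
     (signof (reversal (length lam)) * Hermite_divided.schur lam)"
proof -
  have "Wronskian (map Hermite (degree_seq lam)) = det (mat (length lam) (length lam)
      (\<lambda>(i, j). [:fact (degree_seq lam ! j):] * Hermite_divided (int (degree_seq lam ! j) - int i)))"
    unfolding Wronskian_def
    by (rule arg_cong[of _ _ det], rule eq_matI) (auto simp: higher_pderiv_Hermite degree_seq_def)
  also have "\<dots> = (\<Prod>j<length lam. [:fact (degree_seq lam ! j):]) *
      det (mat (length lam) (length lam) (\<lambda>(i, j). Hermite_divided (int (degree_seq lam ! j) - int i)))"
    by (rule det_mult_cols)
  also have "(\<Prod>j<length lam. [:fact (degree_seq lam ! j) :: real:]) = [:\<Prod>j<length lam. fact (degree_seq lam ! j):]"
    by (rule prod_const_poly)
  finally show ?thesis by (simp add: Hermite_divided.det_degree_seq)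
qed

lemma vandermonde_neq_0:
  assumes "is_partition lam"
  shows "vandermonde (degree_seq lam) \<noteq> 0"
proof -
  have "real (degree_seq lam ! j) - real (degree_seq lam ! i) \<noteq> 0" if "i < j" "j < length lam" for i j
  proof -
    have "lam ! j \<le> lam ! i"
      using assms that by (auto simp: is_partition_def sorted_wrt_iff_nth_less)
    thus ?thesis using that by (simp add: degree_seq_def)
  qed
  moreover have "length (degree_seq lam) = length lam"
    by (simp add: degree_seq_def)
  ultimately show ?thesis
    by (simp add: vandermonde_def)
qed

text \<open>The factorials and the reversal sign are common to numerator and denominator, so only
  the quotient of the two \<open>schur\<close> values survives.\<close>

lemma smult_Wronskian_Hermite:
  assumes "is_partition lam"
  shows "smult (inv_fact.schur lam) (Wronskian_Hermite lam) = Hermite_divided.schur lam"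
proof -
  define P \<epsilon> where "P = (\<Prod>j<length lam. fact (degree_seq lam ! j) :: real)"
    and "\<epsilon> = (signof (reversal (length lam)) :: real)"
  \<comment> \<open>The sign occurs both as a polynomial and as a real; this makes it a scalar in
    both places.\<close>
  have \<epsilon>: "signof (reversal (length lam)) * p = smult \<epsilon> p" for p :: "real poly"
    by (simp add: \<epsilon>_def sign_def)
  \<comment> \<open>The Vandermonde product is nonzero, hence so is each factor to be
    cancelled.\<close>
  have "P * (\<epsilon> * inv_fact.schur lam) \<noteq> 0"
    using vandermonde_neq_0[OF assms] by (simp add: vandermonde_degree_seq P_def \<epsilon>_def)
  thus ?thesis
    by (simp add: Wronskian_Hermite_def vandermonde_degree_seq Wronskian_degree_seq \<epsilon>
        flip: P_def \<epsilon>_def)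
qed

subsection \<open>Removing cells from a partition\<close>

lemma part_pos_iff: "is_partition lam \<Longrightarrow> 0 < part lam i \<longleftrightarrow> i < length lam"
  by (auto simp: is_partition_def part_def in_set_conv_nth) 

lemma part_antimono:
  assumes "is_partition lam" "i \<le> j"
  shows "part lam j \<le> part lam i"
  using assms by (cases "i = j") (auto simp: is_partition_def part_def sorted_wrt_iff_nth_less)

lemma part_inject:
  assumes "is_partition mu" "is_partition nu" "part mu = part nu"
  shows "mu = nu"
proof (rule nth_equalityI)
  have "i < length mu \<longleftrightarrow> i < length nu" for i
    using assms part_pos_iff[of mu i] part_pos_iff[of nu i] by simp
  thus len: "length mu = length nu"
    by (meson linorder_neqE_nat less_irrefl)
  fix i assume "i < length mu"
  thus "mu ! i = nu ! i"
    using fun_cong[OF assms(3), of i] len by (simp add: part_def)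
qed

text \<open>Only meaningful for weakly decreasing, eventually zero functions.\<close>

definition of_parts :: "(nat \<Rightarrow> nat) \<Rightarrow> nat list" where
  "of_parts f = (THE lam. is_partition lam \<and> part lam = f)"

lemma of_parts_part: "is_partition lam \<Longrightarrow> of_parts (part lam) = lam"
  unfolding of_parts_def by (rule the_equality) (auto intro: part_inject)

lemma
  assumes "\<And>i. f (Suc i) \<le> f i" "f N = 0"
  shows is_partition_of_parts: "is_partition (of_parts f)"
    and part_of_parts: "part (of_parts f) = f"
proof -
  \<comment> \<open>Since \<open>f\<close> is weakly decreasing, \<open>m\<close> counts its nonzero
    values and is the length of the partition.\<close>
  define m where "m = (LEAST i. f i = 0)"
  have f_m: "f m = 0" unfolding m_def using assms(2) by (rule LeastI)
  have f_pos: "f i > 0" if "i < m" for i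
    using not_less_Least[of i "\<lambda>i. f i = 0"] that unfolding m_def by simp
  have anti: "f j \<le> f i" if "i \<le> j" for i j
    using assms(1) that by (rule lift_Suc_antimono_le)
  let ?lam = "map f [0..<m]"
  have "0 \<notin> set ?lam" using f_pos by fastforce
  hence "is_partition ?lam"
    by (simp add: is_partition_def sorted_wrt_iff_nth_less anti)
  moreover have "part ?lam = f"
  proof
    fix i
    show "part ?lam i = f i"
      using anti[of m i] f_m by (cases "i < m") (simp_all add: part_def)
  qed
  moreover from this have "of_parts f = ?lam"
    using of_parts_part[of ?lam] calculation by simp
  ultimately show "is_partition (of_parts f)" "part (of_parts f) = f"
    by simp_all
qed

lemma sum_list_part:
  assumes "length lam \<le> N"
  shows "sum_list lam = (\<Sum>i<N. part lam i)"
proof -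
  have "sum_list lam = (\<Sum>i<length lam. part lam i)"
    by (simp add: sum_list_sum_nth part_def atLeast0LessThan)
  also have "\<dots> = (\<Sum>i<N. part lam i)"
    using assms by (intro sum.mono_neutral_left) (auto simp: part_def)
  finally show ?thesis .
qed

lemma part_le_length:
  assumes "is_partition mu" "is_partition lam" "part_le mu lam"
  shows "length mu \<le> length lam"
proof (rule ccontr)
  assume "\<not> ?thesis"
  hence "0 < part mu (length lam)" using part_pos_iff[OF assms(1)] by simp
  thus False using assms(3) by (auto simp: part_le_def part_def dest: spec[of _ "length lam"])
qed

lemma sum_part_diff:
  assumes "is_partition lam" "mu \<in> T_set k lam"
  shows "(\<Sum>i<length lam. part lam i - part mu i) = k"
proof -
  have mu: "is_partition mu" "part_le mu lam" "sum_list mu + k = sum_list lam"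
    using assms(2) by (auto simp: T_set_def)
  have "(\<Sum>i<length lam. part lam i - part mu i) + sum_list mu =
      (\<Sum>i<length lam. (part lam i - part mu i) + part mu i)"
    unfolding sum.distrib using part_le_length[OF mu(1) assms(1) mu(2)] by (simp add: sum_list_part)
  also have "\<dots> = sum_list lam"
    using mu(2) by (simp add: part_le_def sum_list_part[of lam "length lam"])
  finally show ?thesis using mu(3) by simp
qed

text \<open>The row differences are nonnegative and add up to \<open>k\<close>. Once the rows in
  \<open>A\<close> account for all \<open>k\<close> removed cells, no other row can change.\<close>

lemma part_eq_outside:
  assumes "is_partition lam" "mu \<in> T_set k lam"
    and "A \<subseteq> {..<length lam}" "(\<Sum>i\<in>A. part lam i - part mu i) = k" "i \<notin> A"
  shows "part mu i = part lam i"
proof (cases "i < length lam")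
  case True
  have "(\<Sum>i<length lam. part lam i - part mu i) =
      (\<Sum>i\<in>{..<length lam} - A. part lam i - part mu i) + (\<Sum>i\<in>A. part lam i - part mu i)"
    using assms(3) by (intro sum.subset_diff) auto
  hence "(\<Sum>i\<in>{..<length lam} - A. part lam i - part mu i) = 0"
    using sum_part_diff[OF assms(1,2)] assms(4) by simp
  hence "part lam i - part mu i = 0"
    using True assms(5) by auto
  thus ?thesis using assms(2) by (auto simp: T_set_def part_le_def intro: antisym)
next
  case False
  hence "part lam i = 0" by (simp add: part_def)
  thus ?thesis using assms(2) by (auto simp: T_set_def part_le_def dest: spec[of _ i])
qed

lemma T_set_of_parts:
  assumes lam: "is_partition lam"
    and anti: "\<And>i. f (Suc i) \<le> f i" and le: "\<And>i. f i \<le> part lam i"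
    and k: "(\<Sum>i<length lam. part lam i - f i) = k"
  shows "of_parts f \<in> T_set k lam" "part (of_parts f) = f"
proof -
  have "f (length lam) = 0" using le[of "length lam"] by (simp add: part_def)
  note f = is_partition_of_parts[of f, OF anti this] part_of_parts[of f, OF anti this]
  have part_le: "part_le (of_parts f) lam"
    by (simp add: part_le_def f le)
  have "sum_list (of_parts f) = (\<Sum>i<length lam. f i)"
    using sum_list_part[OF part_le_length[OF f(1) lam part_le]] f(2) by simp
  moreover have "(\<Sum>i<length lam. part lam i - f i) + (\<Sum>i<length lam. f i) = sum_list lam"
    by (simp add: sum_list_part[of lam "length lam"] le flip: sum.distrib)
  ultimately show "of_parts f \<in> T_set k lam"
    using f part_le k by (simp add: T_set_def)
  show "part (of_parts f) = f" by (rule f)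
qed

section \<open>Removable corners and dominoes\<close>

definition corner_rows :: "nat list \<Rightarrow> nat set" where
  "corner_rows lam = {i. part lam (Suc i) < part lam i}"

definition horizontal_rows :: "nat list \<Rightarrow> nat set" where
  "horizontal_rows lam = {i. part lam (Suc i) + 2 \<le> part lam i}"

text \<open>A vertical domino is recorded by its upper row.\<close>

definition vertical_rows :: "nat list \<Rightarrow> nat set" where
  "vertical_rows lam = {i. part lam (Suc i) = part lam i \<and> part lam (Suc (Suc i)) < part lam (Suc i)}"

definition remove_cell :: "nat list \<Rightarrow> nat \<Rightarrow> nat list" where
  "remove_cell lam i = of_parts ((part lam)(i := part lam i - 1))"

definition remove_horizontal :: "nat list \<Rightarrow> nat \<Rightarrow> nat list" where
  "remove_horizontal lam i = of_parts ((part lam)(i := part lam i - 2))"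

definition remove_vertical :: "nat list \<Rightarrow> nat \<Rightarrow> nat list" where
  "remove_vertical lam i =
     of_parts ((part lam)(i := part lam i - 1, Suc i := part lam (Suc i) - 1))"

lemma part_pos_imp_less: "0 < part lam i \<Longrightarrow> i < length lam"
  by (auto simp: part_def split: if_splits)

lemma rows_subset:
  "corner_rows lam \<subseteq> {..<length lam}"
  "horizontal_rows lam \<subseteq> {..<length lam}"
  "vertical_rows lam \<subseteq> {..<length lam}"
  by (auto simp: corner_rows_def horizontal_rows_def vertical_rows_def intro!: part_pos_imp_less)

lemma sum_single_diff:
  fixes i n :: nat
  assumes "i < n"
  shows "(\<Sum>l<n. f l - (f(i := f i - k)) l) = (f i - (f i - k) :: nat)"
  using assms by (subst sum.remove[of _ i]) (auto intro!: sum.neutral)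

lemma
  assumes lam: "is_partition lam" and i: "i \<in> corner_rows lam"
  shows remove_cell_T_set: "remove_cell lam i \<in> T_set 1 lam"
    and part_remove_cell: "part (remove_cell lam i) = (part lam)(i := part lam i - 1)"
proof -
  have "i < length lam" using i rows_subset by auto
  hence "(\<Sum>l<length lam. part lam l - ((part lam)(i := part lam i - 1)) l) = 1"
    using i by (simp only: sum_single_diff) (simp add: corner_rows_def)
  moreover have "((part lam)(i := part lam i - 1)) (Suc l) \<le> ((part lam)(i := part lam i - 1)) l" for l
    using i part_antimono[OF lam, of l "Suc l"] by (auto simp: corner_rows_def)
  ultimately show "remove_cell lam i \<in> T_set 1 lam"
    "part (remove_cell lam i) = (part lam)(i := part lam i - 1)"
    unfolding remove_cell_def by (auto intro!: T_set_of_parts[OF lam])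
qed

lemma
  assumes lam: "is_partition lam" and i: "i \<in> horizontal_rows lam"
  shows remove_horizontal_T_set: "remove_horizontal lam i \<in> T_set 2 lam"
    and part_remove_horizontal: "part (remove_horizontal lam i) = (part lam)(i := part lam i - 2)"
proof -
  have "i < length lam" using i rows_subset by auto
  hence "(\<Sum>l<length lam. part lam l - ((part lam)(i := part lam i - 2)) l) = 2"
    using i by (simp only: sum_single_diff) (simp add: horizontal_rows_def)
  moreover have "((part lam)(i := part lam i - 2)) (Suc l) \<le> ((part lam)(i := part lam i - 2)) l" for l
    using i part_antimono[OF lam, of l "Suc l"] by (auto simp: horizontal_rows_def)
  ultimately show "remove_horizontal lam i \<in> T_set 2 lam"
    "part (remove_horizontal lam i) = (part lam)(i := part lam i - 2)"
    unfolding remove_horizontal_def by (auto intro!: T_set_of_parts[OF lam])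
qed

lemma
  assumes lam: "is_partition lam" and i: "i \<in> vertical_rows lam"
  shows remove_vertical_T_set: "remove_vertical lam i \<in> T_set 2 lam"
    and part_remove_vertical: "part (remove_vertical lam i) =
      (part lam)(i := part lam i - 1, Suc i := part lam (Suc i) - 1)"
proof -
  let ?f = "(part lam)(i := part lam i - 1, Suc i := part lam (Suc i) - 1)"
  have pos: "0 < part lam i" "0 < part lam (Suc i)" using i by (auto simp: vertical_rows_def)
  hence less: "Suc i < length lam" by (auto intro: part_pos_imp_less)
  have "(\<Sum>l<length lam. part lam l - ?f l) = (\<Sum>l\<in>{i, Suc i}. part lam l - ?f l)"
    using less by (intro sum.mono_neutral_right) auto
  also have "\<dots> = 2" using pos by simp
  finally have "(\<Sum>l<length lam. part lam l - ?f l) = 2" .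
  moreover have "?f (Suc l) \<le> ?f l" for l
    using i part_antimono[OF lam, of l "Suc l"] by (auto simp: vertical_rows_def)
  ultimately show "remove_vertical lam i \<in> T_set 2 lam" "part (remove_vertical lam i) = ?f"
    unfolding remove_vertical_def by (auto intro!: T_set_of_parts[OF lam])
qed

text \<open>Surjectivity: nonnegative integer row differences with sum 1 single out one row, and it
  ends in a corner because \<open>mu\<close> is weakly decreasing.\<close>

lemma bij_betw_remove_cell:
  assumes lam: "is_partition lam"
  shows "bij_betw (remove_cell lam) (corner_rows lam) (T_set 1 lam)"
  unfolding bij_betw_def
proof (intro conjI equalityI subsetI)
  show "inj_on (remove_cell lam) (corner_rows lam)"
  proof (rule inj_onI)
    fix i j assume ij: "i \<in> corner_rows lam" "j \<in> corner_rows lam"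
      and eq: "remove_cell lam i = remove_cell lam j"
    have "((part lam)(i := part lam i - 1)) i = ((part lam)(j := part lam j - 1)) i"
      using part_remove_cell[OF lam ij(1)] part_remove_cell[OF lam ij(2)] eq by simp
    thus "i = j" using ij by (auto simp: corner_rows_def split: if_splits)
  qed
  fix mu assume "mu \<in> remove_cell lam ` corner_rows lam"
  thus "mu \<in> T_set 1 lam" using remove_cell_T_set[OF lam] by auto
next
  fix mu assume mu: "mu \<in> T_set 1 lam"
  hence mu': "is_partition mu" "part_le mu lam" by (auto simp: T_set_def)
  have "\<exists>i\<in>{..<length lam}. part lam i - part mu i \<noteq> 0"
  proof (rule ccontr)
    assume "\<not> ?thesis"
    hence "(\<Sum>i<length lam. part lam i - part mu i) = 0" by (intro sum.neutral) auto
    thus False using sum_part_diff[OF lam mu] by simp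
  qed
  then obtain i where i: "i < length lam" "part lam i - part mu i \<noteq> 0" by auto
  have "part lam i - part mu i \<le> (\<Sum>i<length lam. part lam i - part mu i)"
    using i by (intro member_le_sum) auto
  hence i1: "part lam i - part mu i = 1"
    using i sum_part_diff[OF lam mu] by simp
  have out: "part mu l = part lam l" if "l \<noteq> i" for l
    using part_eq_outside[OF lam mu, of "{i}" l] i i1 that by simp
  have *: "part mu = (part lam)(i := part lam i - 1)"
    using out i1 by fastforce
  have "part mu (Suc i) \<le> part mu i" using mu'(1) by (rule part_antimono) simp
  hence "i \<in> corner_rows lam" using * i1 by (auto simp: corner_rows_def)
  moreover have "mu = remove_cell lam i"
    using of_parts_part[OF mu'(1)] by (simp add: remove_cell_def *)
  ultimately show "mu \<in> remove_cell lam ` corner_rows lam" by blast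
qed

text \<open>Surjectivity: the row that loses two cells accounts for everything removed, so all other
  rows stay fixed.\<close>

lemma bij_betw_remove_horizontal:
  assumes lam: "is_partition lam"
  shows "bij_betw (remove_horizontal lam) (horizontal_rows lam) (T2_horizontal lam)"
  unfolding bij_betw_def
proof (intro conjI equalityI subsetI)
  show "inj_on (remove_horizontal lam) (horizontal_rows lam)"
  proof (rule inj_onI)
    fix i j assume ij: "i \<in> horizontal_rows lam" "j \<in> horizontal_rows lam"
      and eq: "remove_horizontal lam i = remove_horizontal lam j"
    have "((part lam)(i := part lam i - 2)) i = ((part lam)(j := part lam j - 2)) i"
      using part_remove_horizontal[OF lam ij(1)] part_remove_horizontal[OF lam ij(2)] eq by simp
    thus "i = j" using ij by (auto simp: horizontal_rows_def split: if_splits)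
  qed
  fix mu assume "mu \<in> remove_horizontal lam ` horizontal_rows lam"
  then obtain i where i: "i \<in> horizontal_rows lam" "mu = remove_horizontal lam i" by blast
  hence "part mu i + 2 = part lam i"
    using part_remove_horizontal[OF lam i(1)] by (simp add: horizontal_rows_def)
  thus "mu \<in> T2_horizontal lam"
    using remove_horizontal_T_set[OF lam i(1)] i(2) by (auto simp: T2_horizontal_def)
next
  fix mu assume "mu \<in> T2_horizontal lam"
  then obtain i where mu: "mu \<in> T_set 2 lam" and i: "part mu i + 2 = part lam i"
    by (auto simp: T2_horizontal_def)
  hence mu': "is_partition mu" by (auto simp: T_set_def)
  have "i < length lam" using i by (intro part_pos_imp_less) simp
  hence "part mu l = part lam l" if "l \<noteq> i" for l
    using part_eq_outside[OF lam mu, of "{i}" l] that by (simp flip: i)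
  hence *: "part mu = (part lam)(i := part lam i - 2)"
    using i by fastforce
  have "part mu (Suc i) \<le> part mu i" using mu' by (rule part_antimono) simp
  hence "i \<in> horizontal_rows lam" using * i by (auto simp: horizontal_rows_def)
  moreover have "mu = remove_horizontal lam i"
    using of_parts_part[OF mu'] by (simp add: remove_horizontal_def *)
  ultimately show "mu \<in> remove_horizontal lam ` horizontal_rows lam" by blast
qed

lemma bij_betw_remove_vertical:
  assumes lam: "is_partition lam"
  shows "bij_betw (remove_vertical lam) (vertical_rows lam) (T2_vertical lam)"
  unfolding bij_betw_def
proof (intro conjI equalityI subsetI)
  show "inj_on (remove_vertical lam) (vertical_rows lam)"
  proof (rule inj_onI)
    fix i j assume ij: "i \<in> vertical_rows lam" "j \<in> vertical_rows lam"
      and eq: "remove_vertical lam i = remove_vertical lam j"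
    let ?f = "\<lambda>i. (part lam)(i := part lam i - 1, Suc i := part lam (Suc i) - 1)"
    have eq': "?f i l = ?f j l" for l
      using part_remove_vertical[OF lam ij(1)] part_remove_vertical[OF lam ij(2)] eq by simp
    \<comment> \<open>Row \<open>i\<close> shrinks, so \<open>i\<close> is \<open>j\<close> or
      \<open>Suc j\<close>; symmetrically \<open>j\<close> is \<open>i\<close> or
      \<open>Suc i\<close>. Together these force \<open>i = j\<close>.\<close>
    show "i = j" using ij eq'[of i] eq'[of j]
      by (auto simp: vertical_rows_def split: if_splits)
  qed
  fix mu assume "mu \<in> remove_vertical lam ` vertical_rows lam"
  then obtain i where i: "i \<in> vertical_rows lam" "mu = remove_vertical lam i" by blast
  hence "part mu i = part mu (Suc i) \<and>
        part mu i + 1 = part lam i \<and> part mu (Suc i) + 1 = part lam (Suc i)"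
    using part_remove_vertical[OF lam i(1)] by (auto simp: vertical_rows_def)
  thus "mu \<in> T2_vertical lam"
    using remove_vertical_T_set[OF lam i(1)] i(2) by (auto simp: T2_vertical_def)
next
  fix mu assume "mu \<in> T2_vertical lam"
  then obtain i where mu: "mu \<in> T_set 2 lam" and i: "part mu i = part mu (Suc i)"
    "part lam i = part mu i + 1" "part lam (Suc i) = part mu (Suc i) + 1"
    by (auto simp: T2_vertical_def)
  hence mu': "is_partition mu" by (auto simp: T_set_def)
  have "Suc i < length lam" using i by (intro part_pos_imp_less) simp
  hence out: "part mu l = part lam l" if "l \<notin> {i, Suc i}" for l
    using part_eq_outside[OF lam mu, of "{i, Suc i}" l] that i by simp
  have *: "part mu = (part lam)(i := part lam i - 1, Suc i := part lam (Suc i) - 1)"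
    using i out by (intro ext) auto
  have "part mu (Suc (Suc i)) \<le> part mu (Suc i)" using mu' by (rule part_antimono) simp
  hence "i \<in> vertical_rows lam" using out[of "Suc (Suc i)"] i by (auto simp: vertical_rows_def)
  moreover have "mu = remove_vertical lam i"
    using of_parts_part[OF mu'] unfolding remove_vertical_def * by simp
  ultimately show "mu \<in> remove_vertical lam ` vertical_rows lam" by blast
qed

section \<open>The recurrence for Jacobi-Trudi determinants\<close>

context appell_coefficients
begin

text \<open>Removing cells can shorten a partition; padding with zero parts keeps all determinants
  at the size given by \<open>lam\<close>.\<close>

lemma shifted_det_eq_schur:
  assumes "length lam \<le> N"
  shows "shifted_det N (shifted_part lam) = schur lam"
  using assms
proof (induction N rule: dec_induct)
  case base
  show ?case by (simp add: schur_def)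
next
  case (step N)
  hence "shifted_det (Suc N) (shifted_part lam) = shifted_det N (shifted_part lam)"
    by (intro shifted_det_Suc) (simp add: shifted_part_def part_def)
  thus ?case using step by simp
qed

lemma shifted_det_eq_schur_of_part:
  assumes "is_partition lam" "mu \<in> T_set k lam" "\<And>l. l < length lam \<Longrightarrow> b l = int (part mu l) - int l"
  shows "shifted_det (length lam) b = schur mu"
proof -
  have "length mu \<le> length lam"
    using assms(1,2) by (intro part_le_length) (auto simp: T_set_def)
  hence "schur mu = shifted_det (length lam) (shifted_part mu)" by (simp add: shifted_det_eq_schur)
  also have "\<dots> = shifted_det (length lam) b"
    using assms(3) by (intro shifted_det_cong) (simp add: shifted_part_def)
  finally show ?thesis by simp
qed

text \<open>
  If row \<open>j\<close> does not end in a corner, lowering its entry makes columns \<open>j\<close> and \<open>j + 1\<close> equal.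
\<close>

lemma sum_shifted_det_minus_1:
  assumes lam: "is_partition lam"
  defines "b \<equiv> shifted_part lam"
  shows "(\<Sum>j<length lam. shifted_det (length lam) (b(j := b j - 1))) = (\<Sum>mu\<in>T_set 1 lam. schur mu)"
proof -
  let ?N = "length lam"
  have "(\<Sum>j<?N. shifted_det ?N (b(j := b j - 1))) = (\<Sum>j\<in>corner_rows lam. shifted_det ?N (b(j := b j - 1)))"
  proof (intro sum.mono_neutral_right ballI)
    fix j assume j: "j \<in> {..<?N} - corner_rows lam"
    hence eq: "part lam (Suc j) = part lam j"
      using part_antimono[OF lam, of j "Suc j"] by (auto simp: corner_rows_def)
    moreover have "0 < part lam j" using j part_pos_iff[OF lam] by simp
    \<comment> \<open>Row \<open>Suc j\<close> is as long as row \<open>j\<close>, hence nonempty,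
      so column \<open>Suc j\<close> lies inside the matrix.\<close>
    ultimately have "Suc j < ?N" using part_pos_iff[OF lam] by metis
    thus "shifted_det ?N (b(j := b j - 1)) = 0"
      using j eq by (intro shifted_det_eq_zero[of j _ "Suc j"]) (auto simp: b_def shifted_part_def)
  qed (use rows_subset in auto)
  also have "\<dots> = (\<Sum>j\<in>corner_rows lam. schur (remove_cell lam j))"
  proof (intro sum.cong refl shifted_det_eq_schur_of_part[OF lam])
    fix j l assume j: "j \<in> corner_rows lam"
    show "remove_cell lam j \<in> T_set 1 lam" by (rule remove_cell_T_set[OF lam j])
    show "(b(j := b j - 1)) l = int (part (remove_cell lam j) l) - int l"
      using j by (auto simp: part_remove_cell[OF lam j] b_def shifted_part_def corner_rows_def)
  qed
  also have "\<dots> = (\<Sum>mu\<in>T_set 1 lam. schur mu)"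
    by (rule sum.reindex_bij_betw[OF bij_betw_remove_cell[OF lam]])
  finally show ?thesis .
qed

text \<open>
  Lowering by 2 either keeps the sequence strictly decreasing (a horizontal domino is removed), or
  makes it so after swapping columns \<open>j\<close> and \<open>j + 1\<close> (a vertical domino, with a sign), or creates
  two equal columns or a zero column.
\<close>

lemma sum_shifted_det_minus_2:
  assumes lam: "is_partition lam"
  defines "b \<equiv> shifted_part lam"
  shows "(\<Sum>j<length lam. shifted_det (length lam) (b(j := b j - 2))) =
     (\<Sum>mu\<in>T2_horizontal lam. schur mu) - (\<Sum>mu\<in>T2_vertical lam. schur mu)"
proof -
  let ?N = "length lam"
  let ?R = "\<lambda>j. shifted_det ?N (b(j := b j - 2))"
  have "(\<Sum>j<?N. ?R j) = (\<Sum>j\<in>horizontal_rows lam \<union> vertical_rows lam. ?R j)"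
  proof (intro sum.mono_neutral_right ballI)
    fix j assume "j \<in> {..<?N} - (horizontal_rows lam \<union> vertical_rows lam)"
    hence j: "j < ?N" "j \<notin> horizontal_rows lam" "j \<notin> vertical_rows lam" by auto
    have pos: "0 < part lam j" using j part_pos_iff[OF lam] by simp
    have "part lam j = part lam (Suc j) \<or> part lam j = part lam (Suc j) + 1"
      using part_antimono[OF lam, of j "Suc j"] j(2) by (auto simp: horizontal_rows_def)
    thus "?R j = 0"
    proof
      assume eq: "part lam j = part lam (Suc j)"
      hence eq2: "part lam (Suc (Suc j)) = part lam j"
        using part_antimono[OF lam, of "Suc j" "Suc (Suc j)"] j(3) by (auto simp: vertical_rows_def)
      hence "Suc (Suc j) < ?N" using part_pos_iff[OF lam] pos by metis
      \<comment> \<open>Three equal parts: \<open>part lam j - j - 2\<close> is the shifted value at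
        \<open>j + 2\<close>.\<close>
      thus ?thesis
        using j eq2 by (intro shifted_det_eq_zero[of j _ "Suc (Suc j)"]) (auto simp: b_def shifted_part_def)
    next
      assume eq: "part lam j = part lam (Suc j) + 1"
      show ?thesis
      proof (cases "Suc j < ?N")
        case True
        thus ?thesis
          using j eq by (intro shifted_det_eq_zero[of j _ "Suc j"]) (auto simp: b_def shifted_part_def)
      next
        case False
        hence "part lam (Suc j) = 0" "?N = Suc j" using j by (auto simp: part_def)
        \<comment> \<open>The last part is 1, so the lowered value is
          \<open>1 - j - 2 = - int ?N\<close>, which gives a zero column.\<close>
        thus ?thesis using eq by (intro shifted_det_neg_eq_zero[of j]) (auto simp: b_def shifted_part_def)
      qed
    qed
  qed (use rows_subset in auto)
  also have "\<dots> = (\<Sum>j\<in>horizontal_rows lam. ?R j) + (\<Sum>j\<in>vertical_rows lam. ?R j)"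
    using rows_subset[of lam]
    by (intro sum.union_disjoint) (auto intro: finite_subset simp: horizontal_rows_def vertical_rows_def)
  also have "(\<Sum>j\<in>horizontal_rows lam. ?R j) = (\<Sum>j\<in>horizontal_rows lam. schur (remove_horizontal lam j))"
  proof (intro sum.cong refl shifted_det_eq_schur_of_part[OF lam])
    fix j l assume j: "j \<in> horizontal_rows lam"
    show "remove_horizontal lam j \<in> T_set 2 lam" by (rule remove_horizontal_T_set[OF lam j])
    show "(b(j := b j - 2)) l = int (part (remove_horizontal lam j) l) - int l"
      using j by (auto simp: part_remove_horizontal[OF lam j] b_def shifted_part_def horizontal_rows_def)
  qed
  also have "\<dots> = (\<Sum>mu\<in>T2_horizontal lam. schur mu)"
    by (rule sum.reindex_bij_betw[OF bij_betw_remove_horizontal[OF lam]])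
  also have "(\<Sum>j\<in>vertical_rows lam. ?R j) = (\<Sum>j\<in>vertical_rows lam. - schur (remove_vertical lam j))"
  proof (intro sum.cong refl)
    fix j assume j: "j \<in> vertical_rows lam"
    hence pos: "0 < part lam j" "0 < part lam (Suc j)" by (auto simp: vertical_rows_def)
    hence less: "Suc j < ?N" by (auto intro: part_pos_imp_less)
    \<comment> \<open>With \<open>p\<close> the common value of parts \<open>j\<close> and
      \<open>Suc j\<close>, the swapped values are \<open>p - j - 1\<close> and
      \<open>p - j - 2\<close>: both parts have dropped to \<open>p - 1\<close>.\<close>
    have "shifted_det ?N (b(j := b j - 2) \<circ> transpose j (Suc j)) = schur (remove_vertical lam j)"
    proof (rule shifted_det_eq_schur_of_part[OF lam])
      show "remove_vertical lam j \<in> T_set 2 lam" by (rule remove_vertical_T_set[OF lam j])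
      fix l
      show "(b(j := b j - 2) \<circ> transpose j (Suc j)) l = int (part (remove_vertical lam j) l) - int l"
        using j pos
        by (auto simp: part_remove_vertical[OF lam j] b_def shifted_part_def vertical_rows_def
            transpose_def of_nat_diff)
    qed
    thus "?R j = - schur (remove_vertical lam j)"
      using less by (simp add: shifted_det_transpose flip: minus_equation_iff)
  qed
  also have "\<dots> = - (\<Sum>mu\<in>T2_vertical lam. schur mu)"
    unfolding sum_negf by (simp add: sum.reindex_bij_betw[OF bij_betw_remove_vertical[OF lam]])
  finally show ?thesis by (simp only: diff_conv_add_uminus)
qed

text \<open>The shifts in \<open>shifted_part\<close> cancel against the sum of the column indices,
  so the factor in \<open>shifted_det_rec\<close> is the size. The domino signs are opposite to
  \<open>domino_sgn\<close>; the Hermite value \<open>y = -1\<close> turns them around.\<close>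

lemma schur_rec:
  assumes lam: "is_partition lam"
  shows "of_nat (sum_list lam) * schur lam = x * (\<Sum>mu\<in>T_set 1 lam. schur mu) +
     y * ((\<Sum>mu\<in>T2_horizontal lam. schur mu) - (\<Sum>mu\<in>T2_vertical lam. schur mu))"
proof -
  have "(\<Sum>j<length lam. shifted_part lam j) + (\<Sum>j<length lam. int j) = int (sum_list lam)"
    by (simp add: sum_list_part[of lam "length lam"] shifted_part_def flip: sum.distrib)
  thus ?thesis
    using shifted_det_rec[of "shifted_part lam" "length lam"]
    unfolding sum_shifted_det_minus_1[OF lam] sum_shifted_det_minus_2[OF lam]
    by (simp add: schur_def)
qed

end

subsection \<open>The branching rule for standard Young tableaux\<close>

lemma young_diagram_part: "young_diagram lam = {(i, j). j < part lam i}"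
  by (auto simp: young_diagram_def part_def split: if_splits)

lemma finite_young_diagram: "finite (young_diagram lam)"
proof (rule finite_subset)
  show "young_diagram lam \<subseteq> (SIGMA i:{..<length lam}. {..<part lam i})"
    by (auto simp: young_diagram_def part_def)
qed auto

lemma finite_standard_tableaux: "finite (standard_tableaux lam)"
proof (rule finite_subset)
  show "standard_tableaux lam \<subseteq> young_diagram lam \<rightarrow>\<^sub>E {1..sum_list lam}"
    by (auto simp: standard_tableaux_def bij_betw_def extensional_def)
qed (intro finite_PiE finite_young_diagram finite_atLeastAtMost)

lemma standard_tableauxI:
  assumes "T \<in> extensional (young_diagram lam)" "bij_betw T (young_diagram lam) {1..sum_list lam}"
    and "\<And>i j k. (i, j) \<in> young_diagram lam \<Longrightarrow> (i, k) \<in> young_diagram lam \<Longrightarrow> j < k \<Longrightarrow> T (i, j) < T (i, k)"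
    and "\<And>i j k. (i, j) \<in> young_diagram lam \<Longrightarrow> (k, j) \<in> young_diagram lam \<Longrightarrow> i < k \<Longrightarrow> T (i, j) < T (k, j)"
  shows "T \<in> standard_tableaux lam"
  using assms unfolding standard_tableaux_def by blast

lemma
  assumes "T \<in> standard_tableaux lam"
  shows standard_tableaux_extensional: "T \<in> extensional (young_diagram lam)"
    and standard_tableaux_bij: "bij_betw T (young_diagram lam) {1..sum_list lam}"
  using assms unfolding standard_tableaux_def by blast+

lemma standard_tableaux_row:
  assumes "T \<in> standard_tableaux lam" "(i, j) \<in> young_diagram lam" "(i, k) \<in> young_diagram lam" "j < k"
  shows "T (i, j) < T (i, k)"
  using assms unfolding standard_tableaux_def by blast

lemma standard_tableaux_col:
  assumes "T \<in> standard_tableaux lam" "(i, j) \<in> young_diagram lam" "(k, j) \<in> young_diagram lam" "i < k"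
  shows "T (i, j) < T (k, j)"
  using assms unfolding standard_tableaux_def by blast

lemma young_diagram_remove_cell:
  assumes "is_partition lam" "i \<in> corner_rows lam"
  shows "young_diagram (remove_cell lam i) = young_diagram lam - {(i, part lam i - 1)}"
  using assms by (auto simp: young_diagram_part part_remove_cell split: if_splits)

text \<open>Restriction to the smaller diagram forgets the largest entry; the inverse writes it back
  into the corner.\<close>

lemma standard_tableaux_remove_cell:
  assumes lam: "is_partition lam" and i: "i \<in> corner_rows lam"
  shows "card {T \<in> standard_tableaux lam. T (i, part lam i - 1) = sum_list lam} =
    num_SYT (remove_cell lam i)"
proof -
  define c n mu where "c = (i, part lam i - 1)" and "n = sum_list lam" and "mu = remove_cell lam i"
  let ?Y = "young_diagram lam" and ?Y' = "young_diagram mu"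
  let ?B = "{T \<in> standard_tableaux lam. T c = n}"
  have Y': "?Y' = ?Y - {c}"
    using young_diagram_remove_cell[OF assms] by (simp add: c_def mu_def)
  have c: "c \<in> ?Y" using i by (auto simp: c_def young_diagram_part corner_rows_def)
  have n: "sum_list mu + 1 = n"
    using remove_cell_T_set[OF assms] by (simp add: T_set_def mu_def n_def)
  hence Icc: "{1..sum_list mu} = {1..n} - {n}" by auto
  \<comment> \<open>The corner ends its row and its column, so the largest entry can stand there
    without violating monotonicity.\<close>
  have row_end: "k < part lam i" if "(i, k) \<in> ?Y" for k
    using that by (simp add: young_diagram_part)
  have col_end: "k \<le> i" if "(k, part lam i - 1) \<in> ?Y" for k
  proof (rule ccontr)
    assume "\<not> k \<le> i"
    hence "part lam k \<le> part lam (Suc i)" by (intro part_antimono[OF lam]) simp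
    thus False using that i by (simp add: young_diagram_part corner_rows_def)
  qed
  have "bij_betw (\<lambda>T. restrict T ?Y') ?B (standard_tableaux mu)"
    unfolding bij_betw_def
  proof (intro conjI equalityI subsetI)
    show "inj_on (\<lambda>T. restrict T ?Y') ?B"
    proof (intro inj_onI ext)
      fix T U d assume TU: "T \<in> ?B" "U \<in> ?B" "restrict T ?Y' = restrict U ?Y'"
      \<comment> \<open>Both fillings are \<open>n\<close> at \<open>c\<close>, agree on the smaller
        diagram and are \<open>undefined\<close> outside the larger one.\<close>
      consider "d = c" | "d \<in> ?Y'" | "d \<notin> ?Y" using Y' by auto
      thus "T d = U d"
      proof cases
        case 1
        thus ?thesis using TU(1,2) by simp
      next
        case 2
        thus ?thesis using fun_cong[OF TU(3), of d] by simp
      next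
        case 3
        moreover have "T \<in> extensional ?Y" "U \<in> extensional ?Y"
          using TU(1,2) standard_tableaux_extensional by blast+
        ultimately show ?thesis by (metis extensional_arb)
      qed
    qed
  next
    fix T' assume "T' \<in> (\<lambda>T. restrict T ?Y') ` ?B"
    then obtain T where T: "T \<in> standard_tableaux lam" "T c = n" and T': "T' = restrict T ?Y'"
      by blast
    have bij: "bij_betw T ?Y {1..n}"
      using standard_tableaux_bij[OF T(1)] by (simp add: n_def)
    show "T' \<in> standard_tableaux mu"
    proof (rule standard_tableauxI)
      have "inj_on T (?Y - {c})"
        using bij by (meson bij_betw_def inj_on_diff)
      moreover have "T ` (?Y - {c}) = {1..n} - {n}"
        using bij c T(2) by (subst inj_on_image_set_diff[where C = ?Y]) (simp_all add: bij_betw_def)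
      ultimately show "bij_betw T' ?Y' {1..sum_list mu}"
        unfolding Icc Y' T' by (subst bij_betw_cong[where g = T]) (simp_all add: bij_betw_def)
      show "T' (l, j) < T' (l, k)" if "(l, j) \<in> ?Y'" "(l, k) \<in> ?Y'" "j < k" for l j k
        using standard_tableaux_row[OF T(1), of l j k] that by (simp add: T' Y')
      show "T' (l, j) < T' (k, j)" if "(l, j) \<in> ?Y'" "(k, j) \<in> ?Y'" "l < k" for l j k
        using standard_tableaux_col[OF T(1), of l j k] that by (simp add: T' Y')
    qed (simp add: T')
  next
    fix T' assume T': "T' \<in> standard_tableaux mu"
    define T where "T = T'(c := n)"
    note bij' = standard_tableaux_bij[OF T']
    have lt: "T' d < n" if "d \<in> ?Y'" for d
    proof -
      have "T' d \<in> {1..sum_list mu}" using bij' that by (rule bij_betwE[THEN bspec])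
      thus ?thesis using n by simp
    qed
    have "T \<in> standard_tableaux lam"
    proof (rule standard_tableauxI)
      show "T \<in> extensional ?Y"
        unfolding extensional_def
      proof (intro CollectI allI impI)
        fix d assume "d \<notin> ?Y"
        hence "d \<noteq> c" "d \<notin> ?Y'" using c Y' by auto
        thus "T d = undefined"
          using extensional_arb[OF standard_tableaux_extensional[OF T'], of d] by (simp add: T_def)
      qed
      have "bij_betw T ?Y' {1..sum_list mu}"
        using bij' Y' by (subst bij_betw_cong[where g = T']) (simp_all add: T_def)
      moreover have "c \<notin> ?Y'" "T c \<notin> {1..sum_list mu}"
        using n by (simp_all add: Y' T_def)
      ultimately have "bij_betw T (?Y' \<union> {c}) ({1..sum_list mu} \<union> {T c})"
        by (intro notIn_Un_bij_betw)
      moreover have "?Y' \<union> {c} = ?Y"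
        using c by (auto simp: Y')
      moreover have "{1..sum_list mu} \<union> {T c} = {1..n}"
        using n by (auto simp: T_def)
      ultimately show "bij_betw T ?Y {1..sum_list lam}" by (simp add: n_def)
    next
      fix l j k assume lj: "(l, j) \<in> ?Y" and lk: "(l, k) \<in> ?Y" and less: "j < k"
      have "(l, j) \<noteq> c" using lk less row_end[of k] by (auto simp: c_def)
      hence T_lj: "(l, j) \<in> ?Y'" "T (l, j) = T' (l, j)" using lj Y' by (simp_all add: T_def)
      show "T (l, j) < T (l, k)"
      proof (cases "(l, k) = c")
        case True
        thus ?thesis using T_lj lt[of "(l, j)"] by (simp add: T_def)
      next
        case False
        thus ?thesis using T_lj standard_tableaux_row[OF T', of l j k] lk less Y' by (simp add: T_def)
      qed
    next
      fix l j k assume lj: "(l, j) \<in> ?Y" and kj: "(k, j) \<in> ?Y" and less: "l < k"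
      have "(l, j) \<noteq> c" using kj less col_end[of k] by (auto simp: c_def)
      hence T_lj: "(l, j) \<in> ?Y'" "T (l, j) = T' (l, j)" using lj Y' by (simp_all add: T_def)
      show "T (l, j) < T (k, j)"
      proof (cases "(k, j) = c")
        case True
        thus ?thesis using T_lj lt[of "(l, j)"] by (simp add: T_def)
      next
        case False
        thus ?thesis using T_lj standard_tableaux_col[OF T', of l j k] kj less Y' by (simp add: T_def)
      qed
    qed
    moreover have "T' = restrict T ?Y'"
    proof
      fix d
      show "T' d = restrict T ?Y' d"
        using extensional_arb[OF standard_tableaux_extensional[OF T'], of d] Y'
        by (cases "d \<in> ?Y'") (simp_all add: T_def)
    qed
    moreover have "T c = n" by (simp add: T_def)
    ultimately show "T' \<in> (\<lambda>T. restrict T ?Y') ` ?B" by blast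
  qed
  thus ?thesis
    unfolding num_SYT_def c_def n_def mu_def by (rule bij_betw_same_card)
qed

text \<open>A cell to the right of or below the largest entry would need a still larger one.\<close>

lemma standard_tableau_max_cell:
  assumes lam: "is_partition lam" "lam \<noteq> []" and T: "T \<in> standard_tableaux lam"
  shows "\<exists>i\<in>corner_rows lam. T (i, part lam i - 1) = sum_list lam"
proof -
  let ?Y = "young_diagram lam"
  have bij: "bij_betw T ?Y {1..sum_list lam}" using T by (simp add: standard_tableaux_def)
  hence le: "T c \<le> sum_list lam" if "c \<in> ?Y" for c using that by (auto simp: bij_betw_def)
  have "sum_list lam \<noteq> 0" using lam by (cases lam) (auto simp: is_partition_def)
  hence "sum_list lam \<in> {1..sum_list lam}" unfolding atLeastAtMost_iff by linarith
  hence "sum_list lam \<in> T ` ?Y" using bij by (simp add: bij_betw_def)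
  then obtain i j where c: "(i, j) \<in> ?Y" "T (i, j) = sum_list lam" by auto
  have "(i, Suc j) \<notin> ?Y"
  proof
    assume *: "(i, Suc j) \<in> ?Y"
    hence "T (i, j) < T (i, Suc j)" using T c(1) by (intro standard_tableaux_row) auto
    thus False using le[OF *] c by simp
  qed
  hence j: "j = part lam i - 1" using c by (auto simp: young_diagram_part)
  have "(Suc i, j) \<notin> ?Y"
  proof
    assume *: "(Suc i, j) \<in> ?Y"
    hence "T (i, j) < T (Suc i, j)" using T c(1) by (intro standard_tableaux_col) auto
    thus False using le[OF *] c by simp
  qed
  hence "i \<in> corner_rows lam" using c j by (auto simp: young_diagram_part corner_rows_def)
  thus ?thesis using c j by blast
qed

text \<open>The tableaux are sorted by the corner that holds the largest entry; injectivity makes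
  the classes disjoint.\<close>

lemma num_SYT_rec:
  assumes lam: "is_partition lam" "lam \<noteq> []"
  shows "num_SYT lam = (\<Sum>mu\<in>T_set 1 lam. num_SYT mu)"
proof -
  let ?B = "\<lambda>i. {T \<in> standard_tableaux lam. T (i, part lam i - 1) = sum_list lam}"
  have "standard_tableaux lam = (\<Union>i\<in>corner_rows lam. ?B i)"
    using standard_tableau_max_cell[OF lam] by auto
  hence "num_SYT lam = card (\<Union>i\<in>corner_rows lam. ?B i)"
    by (simp add: num_SYT_def)
  also have "\<dots> = (\<Sum>i\<in>corner_rows lam. card (?B i))"
  proof (rule card_UN_disjoint)
    show "finite (corner_rows lam)"
      using rows_subset(1) by (rule finite_subset) simp
    show "\<forall>i\<in>corner_rows lam. finite (?B i)"
      using finite_standard_tableaux[of lam] by simp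
    show "\<forall>i\<in>corner_rows lam. \<forall>j\<in>corner_rows lam. i \<noteq> j \<longrightarrow> ?B i \<inter> ?B j = {}"
    proof (intro ballI impI equals0I)
      fix i j T assume ij: "i \<in> corner_rows lam" "j \<in> corner_rows lam" "i \<noteq> j"
        and T: "T \<in> ?B i \<inter> ?B j"
      have "inj_on T (young_diagram lam)"
        using T by (auto simp: standard_tableaux_def bij_betw_def)
      hence "(i, part lam i - 1) = (j, part lam j - 1)"
        using T ij by (intro inj_onD[of T "young_diagram lam"])
          (auto simp: young_diagram_part corner_rows_def)
      thus False using ij(3) by simp
    qed
  qed
  also have "\<dots> = (\<Sum>i\<in>corner_rows lam. num_SYT (remove_cell lam i))"
    using standard_tableaux_remove_cell[OF lam(1)] by simp
  also have "\<dots> = (\<Sum>mu\<in>T_set 1 lam. num_SYT mu)"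
    by (rule sum.reindex_bij_betw[OF bij_betw_remove_cell[OF lam(1)]])
  finally show ?thesis .
qed

text \<open>For \<open>x = 1\<close> and \<open>y = 0\<close> the domino terms drop out of
  \<open>schur_rec\<close>; multiplied by \<open>fact (sum_list lam - 1)\<close> it becomes the
  branching rule.\<close>

lemma num_SYT_eq:
  assumes "is_partition lam"
  shows "of_nat (num_SYT lam) = fact (sum_list lam) * inv_fact.schur lam"
  using assms
proof (induction "sum_list lam" arbitrary: lam rule: less_induct)
  case less
  show ?case
  proof (cases "lam = []")
    case True
    thus ?thesis by (simp add: num_SYT_Nil inv_fact.schur_def inv_fact.shifted_det_def)
  next
    case False
    hence "sum_list lam \<noteq> 0" using less.prems by (cases lam) (auto simp: is_partition_def)
    then obtain m where m: "sum_list lam = Suc m" by (metis not0_implies_Suc)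
    have "real (num_SYT lam) = (\<Sum>mu\<in>T_set 1 lam. real (num_SYT mu))"
      using num_SYT_rec[OF less.prems False] by simp
    also have "\<dots> = (\<Sum>mu\<in>T_set 1 lam. fact m * inv_fact.schur mu)"
      using m by (intro sum.cong refl) (auto simp: T_set_def less.hyps)
    also have "\<dots> = fact m * (of_nat (sum_list lam) * inv_fact.schur lam)"
      using inv_fact.schur_rec[OF less.prems] by (simp add: sum_distrib_left)
    also have "\<dots> = fact (sum_list lam) * inv_fact.schur lam"
      using m by (simp add: algebra_simps)
    finally show ?thesis .
  qed
qed

section \<open>Combining tableau counts with Wronskian Hermite polynomials\<close>

lemma smult_sum_right: "smult c (\<Sum>a\<in>A. f a) = (\<Sum>a\<in>A. smult c (f a))"
  by (induction A rule: infinite_finite_induct) (simp_all add: smult_add_right)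

text \<open>The tableau count supplies exactly the factor \<open>inv_fact.schur lam\<close> by which
  \<open>Wronskian_Hermite lam\<close> differs from a \<open>schur\<close> value.\<close>

lemma num_SYT_times_Wronskian_Hermite:
  assumes "is_partition lam"
  shows "of_nat (num_SYT lam) * Wronskian_Hermite lam =
    smult (fact (sum_list lam)) (Hermite_divided.schur lam)"
proof -
  have "of_nat (num_SYT lam) * Wronskian_Hermite lam =
      smult (fact (sum_list lam)) (smult (inv_fact.schur lam) (Wronskian_Hermite lam))"
    by (simp add: of_nat_poly num_SYT_eq[OF assms])
  thus ?thesis by (simp only: smult_Wronskian_Hermite[OF assms])
qed

theorem theorem3p1:
  fixes lam :: "nat list"
  assumes "is_partition lam"
    and "sum_list lam \<ge> 2"
  shows "of_nat (num_SYT lam) * Wronskian_Hermite lam =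
      [:0, 1:] * (\<Sum>mu\<in>T_set 1 lam. of_nat (num_SYT mu) * Wronskian_Hermite mu)
      + of_nat (sum_list lam - 1) *
        (\<Sum>rho\<in>T2_domino lam.
           smult (domino_sgn rho lam) (of_nat (num_SYT rho) * Wronskian_Hermite rho))"
proof -
  let ?s = Hermite_divided.schur
  obtain m where m: "sum_list lam = Suc (Suc m)"
    using assms(2) by (metis Suc_le_D numeral_2_eq_2 Suc_le_mono)
  have fin: "finite (T2_horizontal lam)" "finite (T2_vertical lam)"
    by (auto intro: finite_subset[OF _ finite_T_set[of 2 lam]] simp: T2_horizontal_def T2_vertical_def)
  \<comment> \<open>Partitions in \<open>T_set 1 lam\<close> have size \<open>Suc m\<close> and
    those in \<open>T_set 2 lam\<close> have size \<open>m\<close>, whence the two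
    factorials.\<close>
  have T1: "(\<Sum>mu\<in>T_set 1 lam. of_nat (num_SYT mu) * Wronskian_Hermite mu) =
      smult (fact (Suc m)) (\<Sum>mu\<in>T_set 1 lam. ?s mu)"
    using m unfolding smult_sum_right
    by (intro sum.cong refl) (auto simp: T_set_def num_SYT_times_Wronskian_Hermite)
  have FW: "of_nat (num_SYT rho) * Wronskian_Hermite rho = smult (fact m) (?s rho)"
    if "rho \<in> T_set 2 lam" for rho
    using that m by (auto simp: T_set_def num_SYT_times_Wronskian_Hermite)
  have "(\<Sum>rho\<in>T2_domino lam.
      smult (domino_sgn rho lam) (of_nat (num_SYT rho) * Wronskian_Hermite rho)) =
      (\<Sum>rho\<in>T2_domino lam. smult (domino_sgn rho lam) (smult (fact m) (?s rho)))"
    by (intro sum.cong refl, subst FW) (auto simp: T2_domino_def T2_horizontal_def T2_vertical_def)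
  also have "\<dots> = (\<Sum>rho\<in>T2_horizontal lam. - smult (fact m) (?s rho)) +
      (\<Sum>rho\<in>T2_vertical lam. smult (fact m) (?s rho))"
    unfolding T2_domino_def using fin T2_horizontal_vertical_disjoint[of lam]
    by (subst sum.union_disjoint) (auto simp: domino_sgn_def intro!: arg_cong2[of _ _ _ _ "(+)"] sum.cong)
  also have "\<dots> = - smult (fact m) ((\<Sum>rho\<in>T2_horizontal lam. ?s rho) - (\<Sum>rho\<in>T2_vertical lam. ?s rho))"
    by (simp add: sum_negf smult_diff_right smult_sum_right)
  finally have T2: "(\<Sum>rho\<in>T2_domino lam.
      smult (domino_sgn rho lam) (of_nat (num_SYT rho) * Wronskian_Hermite rho)) = \<dots>" .
  \<comment> \<open>Splitting off the top factor of \<open>fact (sum_list lam)\<close> produces the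
    left-hand side of \<open>schur_rec\<close>.\<close>
  have "of_nat (num_SYT lam) * Wronskian_Hermite lam = smult (fact (Suc m)) (of_nat (sum_list lam) * ?s lam)"
    unfolding num_SYT_times_Wronskian_Hermite[OF assms(1)] m fact_Suc[of "Suc m"]
    by (simp add: of_nat_poly mult.commute del: of_nat_Suc fact_Suc)
  \<comment> \<open>In the domino term, \<open>fact (Suc m) = Suc m * fact m\<close> yields the
    coefficient \<open>sum_list lam - 1\<close>.\<close>
  also have "\<dots> = [:0, 1:] * smult (fact (Suc m)) (\<Sum>mu\<in>T_set 1 lam. ?s mu) +
      of_nat (Suc m) * - smult (fact m) ((\<Sum>rho\<in>T2_horizontal lam. ?s rho) - (\<Sum>rho\<in>T2_vertical lam. ?s rho))"
    unfolding Hermite_divided.schur_rec[OF assms(1)]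
    by (simp add: of_nat_poly smult_diff_right smult_add_right)
  finally show ?thesis
    unfolding T1 T2 using m by simp
qed

end
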